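(* Let $\dot G$ be a signed graph with spectrum $\{[-\lambda]^{m-2},[0]^2,[\lambda]^{m-2}\}$. Suppose every vertex of its underlying graph $G$ has degree $\lambda^2$, $\lambda^2-1$, or $\lambda^2-2$, and at least $\lambda^2+1$ vertices have degree $\lambda^2-1$. Then there is a signed graph $\dot H$ with spectrum $\{[-\lambda]^{m-1},[0]^1,[\lambda]^{m-1}\}$, all of whose vertices have degree $\lambda^2$ or $\lambda^2-1$, containing a vertex whose deletion yields $\dot G$.
   Context: A signed graph $\dot G=(G,\sigma)$ consists of a simple graph $G$ and $\sigma:E(G)\to\{1,-1\}$; its adjacency matrix is that of $G$ with entries of negative edges replaced by $-1$, and its spectrum is the multiset of eigenvalues of this matrix. The degree of a vertex is its degree in the underlying graph. The notation $[\mu]^k$ means eigenvalue $\mu$ with multiplicity $k$. *)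

theory Defs
  imports "Jordan_Normal_Form.Char_Poly"
begin

text \<open>Edges are two-element vertex sets; only the values of \<open>esign\<close> on edges matter.\<close>

record 'a sgraph =
  verts :: "'a set"
  edges :: "'a set set"
  esign :: "'a set \<Rightarrow> int"

locale signed_graph =
  fixes G :: "'a sgraph"
  assumes finite_verts: "finite (verts G)"
    and edge_subset: "e \<in> edges G \<Longrightarrow> e \<subseteq> verts G"
    and edge_card: "e \<in> edges G \<Longrightarrow> card e = 2"
    and edge_sign: "e \<in> edges G \<Longrightarrow> esign G e \<in> {1, -1}"

definition vdegree :: "'a sgraph \<Rightarrow> 'a \<Rightarrow> nat" where
  "vdegree G v = card {e \<in> edges G. v \<in> e}"

definition adj_entry :: "'a sgraph \<Rightarrow> 'a \<Rightarrow> 'a \<Rightarrow> int" where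
  "adj_entry G u v = (if {u, v} \<in> edges G then esign G {u, v} else 0)"

text \<open>The adjacency matrix, with rows and columns ordered by the vertex list \<open>xs\<close>.\<close>

definition adj_matrix :: "'a sgraph \<Rightarrow> 'a list \<Rightarrow> int mat" where
  "adj_matrix G xs =
     mat (length xs) (length xs) (\<lambda>(i, j). adj_entry G (xs ! i) (xs ! j))"

text \<open>
  All complex eigenvalues, with algebraic multiplicity. The choice of the vertex ordering is
  immaterial, see \<open>sg_spectrum_eq\<close> below.
\<close>

definition sg_spectrum :: "'a sgraph \<Rightarrow> complex multiset" where
  "sg_spectrum G =
     proots (char_poly (map_mat of_int
       (adj_matrix G (SOME xs. distinct xs \<and> set xs = verts G))))"

definition delete_vertex :: "'a sgraph \<Rightarrow> 'a \<Rightarrow> 'a sgraph" where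
  "delete_vertex G v =
     \<lparr>verts = verts G - {v}, edges = {e \<in> edges G. v \<notin> e}, esign = esign G\<rparr>"

definition sg_isomorphic :: "'a sgraph \<Rightarrow> 'b sgraph \<Rightarrow> bool" where
  "sg_isomorphic G H \<longleftrightarrow>
     (\<exists>f. bij_betw f (verts G) (verts H) \<and>
          edges H = (\<lambda>e. f ` e) ` edges G \<and>
          (\<forall>e \<in> edges G. esign H (f ` e) = esign G e))"

lemma similar_mat_reorder:
  fixes c :: "'a \<Rightarrow> 'a \<Rightarrow> 'b :: comm_ring_1"
  assumes "distinct xs" "distinct ys" "set xs = set ys"
  shows "similar_mat
           (mat (length xs) (length xs) (\<lambda>(i, j). c (xs ! i) (xs ! j)))
           (mat (length ys) (length ys) (\<lambda>(i, j). c (ys ! i) (ys ! j)))"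
proof -
  define n where "n = length xs"
  have lx: "length xs = n" and ly: "length ys = n"
    using assms by (auto simp: n_def distinct_card[symmetric])
  define P where "P = (\<lambda>(us :: 'a list) (ws :: 'a list). mat n n (\<lambda>(i, j). if us ! i = ws ! j then (1 :: 'b) else 0))"
  have pick: "(\<Sum>k = 0..<n. (if a = ws ! k then 1 else 0) * g (ws ! k)) = (g a :: 'b)"
    if a: "a \<in> set ws" and d: "distinct ws" and l: "length ws = n" for a :: 'a and ws and g
  proof -
    have "(\<Sum>k = 0..<n. (if a = ws ! k then 1 else 0) * g (ws ! k))
        = (\<Sum>w \<in> set ws. (if a = w then 1 else 0) * g w)"
      by (rule sum.reindex_bij_betw)
         (use bij_betw_nth[OF d, of "{0..<n}" "set ws"] l in \<open>auto simp: lessThan_atLeast0\<close>)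
    also have "\<dots> = g a"
      using a by (simp add: if_distrib[of "\<lambda>t. t * _"] cong: if_cong)
    finally show ?thesis .
  qed
  have mem: "xs ! i \<in> set ys" "ys ! i \<in> set xs" if "i < n" for i
    using that assms lx ly nth_mem[of i xs] nth_mem[of i ys] by auto
  have PQ: "P us ws * P ws us = 1\<^sub>m n"
    if us: "distinct us" "length us = n" "distinct ws" "length ws = n"
      and m: "\<And>i. i < n \<Longrightarrow> us ! i \<in> set ws" for us ws
  proof (rule eq_matI)
    fix i j assume ij: "i < dim_row (1\<^sub>m n :: 'b mat)" "j < dim_col (1\<^sub>m n :: 'b mat)"
    have "(P us ws * P ws us) $$ (i, j)
        = (\<Sum>k = 0..<n. (if us ! i = ws ! k then 1 else 0) * (if ws ! k = us ! j then 1 else 0))"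
      using ij by (simp add: P_def scalar_prod_def)
    also have "\<dots> = (if us ! i = us ! j then 1 else 0)"
      using pick[OF m us(3,4), of i "\<lambda>w. if w = us ! j then 1 else 0"] ij by simp
    also have "\<dots> = 1\<^sub>m n $$ (i, j)"
      using ij us nth_eq_iff_index_eq[OF us(1)] by simp
    finally show "(P us ws * P ws us) $$ (i, j) = 1\<^sub>m n $$ (i, j)" .
  qed (auto simp: P_def)
  let ?M = "\<lambda>us :: 'a list. mat n n (\<lambda>(i, j). c (us ! i) (us ! j))"
  have "?M xs = P xs ys * ?M ys * P ys xs"
  proof (rule eq_matI, goal_cases)
    case (1 i j)
    then have ij: "i < n" "j < n" by (auto simp: P_def)
    have row: "(P xs ys * ?M ys) $$ (i, k) = c (xs ! i) (ys ! k)" if "k < n" for k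
      using pick[OF mem(1) assms(2) ly, of i "\<lambda>w. c w (ys ! k)"] ij that
      by (simp add: P_def scalar_prod_def)
    have "(P xs ys * ?M ys * P ys xs) $$ (i, j)
        = (\<Sum>k = 0..<n. (P xs ys * ?M ys) $$ (i, k) * (if ys ! k = xs ! j then 1 else 0))"
      using ij by (simp add: P_def scalar_prod_def)
    also have "\<dots> = (\<Sum>k = 0..<n. (if xs ! j = ys ! k then 1 else 0) * c (xs ! i) (ys ! k))"
      by (rule sum.cong) (auto simp: row)
    also have "\<dots> = c (xs ! i) (xs ! j)"
      using pick[OF mem(1) assms(2) ly, of j "\<lambda>w. c (xs ! i) w"] ij by simp
    finally show ?case using ij by simp
  qed (auto simp: P_def)
  then have "similar_mat (?M xs) (?M ys)"
    by (intro similar_matI[of _ _ "P xs ys" "P ys xs" n] PQ)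
       (use assms lx ly mem in \<open>auto simp: P_def\<close>)
  then show ?thesis by (simp add: lx ly)
qed

lemma sg_spectrum_eq:
  assumes "distinct xs" "set xs = verts G"
  shows "sg_spectrum G = proots (char_poly (map_mat of_int (adj_matrix G xs)))"
proof -
  let ?ys = "SOME xs. distinct xs \<and> set xs = verts G"
  have ys: "distinct ?ys" "set ?ys = verts G"
    using someI[of "\<lambda>xs. distinct xs \<and> set xs = verts G" xs] assms by auto
  have conv: "map_mat of_int (adj_matrix G zs) =
      mat (length zs) (length zs) (\<lambda>(i, j). (of_int (adj_entry G (zs ! i) (zs ! j)) :: complex))"
    for zs by (auto simp: adj_matrix_def)
  show ?thesis
    unfolding sg_spectrum_def conv
    using char_poly_similar[OF similar_mat_reorder[of ?ys xs
        "\<lambda>u v. of_int (adj_entry G u v) :: complex"]] ys assms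
    by simp
qed

end

theory Submission
  imports Defs "Jordan_Normal_Form.Schur_Decomposition"
begin

text \<open>
  Write \<open>A\<close> for the adjacency matrix and \<open>K = \<lambda>\<^sup>2\<close>. The spectrum forces \<open>A\<^sup>3 = K A\<close>, so
  \<open>M = K I - A\<^sup>2\<close> is an integer matrix with \<open>M\<^sup>2 = K M\<close>, \<open>A M = 0\<close> and trace \<open>2 K\<close>, that is,
  \<open>K\<close> times a projection of rank two, and its diagonal entries \<open>K - deg v\<close> lie in \<open>{0, 1, 2}\<close>.
  A column of \<open>M\<close> at a vertex with diagonal entry 1 has square norm \<open>K\<close>, hence it
  vanishes at one of the \<open>K + 1\<close> vertices with diagonal entry 1. This produces two orthogonal
  columns \<open>x\<close>, \<open>y\<close> with \<open>M = x x\<^sup>T + y y\<^sup>T\<close> and entries in \<open>{-1, 0, 1}\<close>. Joining a new vertex to \<open>G\<close>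
  with signs \<open>x\<close> gives a matrix whose square is \<open>K I - y y\<^sup>T\<close> (with \<open>y\<close> extended by 0), from which
  the degrees and the spectrum of the new graph are read off.
\<close>

subsection \<open>Traces of powers and eigenvalues\<close>

definition mat_trace :: "'a :: comm_monoid_add mat \<Rightarrow> 'a" where
  "mat_trace A = (\<Sum>i < dim_row A. A $$ (i, i))"

lemma mat_trace_mult_comm:
  fixes A B :: "'a :: comm_semiring_0 mat"
  assumes "A \<in> carrier_mat n m" "B \<in> carrier_mat m n"
  shows "mat_trace (A * B) = mat_trace (B * A)"
proof -
  have "mat_trace (A * B) = (\<Sum>i<n. \<Sum>j<m. A $$ (i, j) * B $$ (j, i))"
    using assms by (simp add: mat_trace_def scalar_prod_def lessThan_atLeast0)
  also have "\<dots> = (\<Sum>j<m. \<Sum>i<n. B $$ (j, i) * A $$ (i, j))"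
    by (subst sum.swap) (simp add: mult.commute)
  also have "\<dots> = mat_trace (B * A)"
    using assms by (simp add: mat_trace_def scalar_prod_def lessThan_atLeast0)
  finally show ?thesis .
qed

lemma mat_trace_similar:
  fixes A B :: "'a :: comm_ring_1 mat"
  assumes "similar_mat_wit A B P Q"
  shows "mat_trace A = mat_trace B"
proof -
  note w = similar_mat_witD[OF refl assms]
  have "mat_trace A = mat_trace (Q * (P * B))"
    using mat_trace_mult_comm[OF mult_carrier_mat[OF w(6,5)] w(7)] w(3) by simp
  also have "Q * (P * B) = B"
    using assoc_mult_mat[OF w(7,6,5)] w(2) left_mult_one_mat[OF w(5)] by simp
  finally show ?thesis .
qed

lemma upper_triangular_mult:
  fixes A B :: "'a :: comm_ring_1 mat"
  assumes "A \<in> carrier_mat n n" "B \<in> carrier_mat n n"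
    and A: "upper_triangular A" and B: "upper_triangular B"
  shows "upper_triangular (A * B)"
    and "i < n \<Longrightarrow> (A * B) $$ (i, i) = A $$ (i, i) * B $$ (i, i)"
proof -
  have entry: "(A * B) $$ (i, j) = (\<Sum>k<n. A $$ (i, k) * B $$ (k, j))" if "i < n" "j < n" for i j
    using assms(1,2) that by (simp add: scalar_prod_def lessThan_atLeast0)
  have vanish: "A $$ (i, k) * B $$ (k, j) = 0" if "k < n" "i < n" "k < i \<or> j < k" for i j k
    using that(3)
  proof
    assume "k < i"
    then have "A $$ (i, k) = 0" using upper_triangularD[OF A] assms(1) that(2) by simp
    then show ?thesis by simp
  next
    assume "j < k"
    then have "B $$ (k, j) = 0" using upper_triangularD[OF B] assms(2) that(1) by simp
    then show ?thesis by simp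
  qed
  show "upper_triangular (A * B)"
  proof (rule upper_triangularI)
    fix i j assume ij: "j < i" "i < dim_row (A * B)"
    then have "i < n" "j < n" using assms(1) by auto
    then show "(A * B) $$ (i, j) = 0"
      unfolding entry[OF \<open>i < n\<close> \<open>j < n\<close>] using ij by (intro sum.neutral ballI vanish) auto
  qed
  show "(A * B) $$ (i, i) = A $$ (i, i) * B $$ (i, i)" if i: "i < n"
  proof -
    have "(\<Sum>k<n. A $$ (i, k) * B $$ (k, i)) = (\<Sum>k\<in>{i}. A $$ (i, k) * B $$ (k, i))"
      using i by (intro sum.mono_neutral_right) (auto intro!: vanish)
    then show ?thesis using i by (simp add: entry)
  qed
qed

lemma upper_triangular_pow:
  fixes A :: "'a :: comm_ring_1 mat"
  assumes A: "A \<in> carrier_mat n n" "upper_triangular A"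
  shows "upper_triangular (A ^\<^sub>m k) \<and> (\<forall>i<n. (A ^\<^sub>m k) $$ (i, i) = (A $$ (i, i)) ^ k)"
proof (induction k)
  case 0
  then show ?case using A by simp
next
  case (Suc k)
  have "A ^\<^sub>m k \<in> carrier_mat n n" using A by simp
  then show ?case
    using Suc A upper_triangular_mult[of "A ^\<^sub>m k" n A] by (simp add: mult.commute)
qed

lemma proots_prod_linear: "proots (\<Prod>a\<leftarrow>as. [:- a, 1:]) = mset (as :: 'a :: idom list)"
proof (induction as)
  case (Cons a as)
  have "(\<Prod>a\<leftarrow>as. [:- a, 1:]) \<noteq> (0 :: 'a poly)" by (auto simp: prod_list_zero_iff)
  then have "proots ([:- a, 1:] * (\<Prod>a\<leftarrow>as. [:- a, 1:])) = mset (a # as)"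
    using Cons.IH by (subst proots_mult) auto
  then show ?case by simp
qed simp

text \<open>A Schur decomposition gives a similar upper triangular matrix with the eigenvalues on
  its diagonal. Powers keep that shape and raise the diagonal entrywise, while the trace does not
  change under similarity.\<close>

lemma mat_trace_pow:
  fixes A :: "complex mat"
  assumes A: "A \<in> carrier_mat n n"
  shows "mat_trace (A ^\<^sub>m k) = (\<Sum>\<mu>\<in>#proots (char_poly A). \<mu> ^ k)"
proof -
  obtain es where es: "char_poly A = (\<Prod>a\<leftarrow>es. [:- a, 1:])" "length es = n"
    using char_poly_factorized[OF A] by auto
  obtain B P Q where dec: "schur_decomposition A es = (B, P, Q)"
    by (cases "schur_decomposition A es") auto
  have B: "similar_mat_wit A B P Q" "upper_triangular B" "diag_mat B = es"
    using schur_decomposition[OF A es(1) dec] by auto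
  have Bc: "B \<in> carrier_mat n n" using similar_mat_witD2[OF A B(1)] by simp
  have "mat_trace (A ^\<^sub>m k) = mat_trace (B ^\<^sub>m k)"
    using similar_mat_wit_pow[OF B(1)] by (rule mat_trace_similar)
  also have "\<dots> = (\<Sum>i<n. (es ! i) ^ k)"
    using upper_triangular_pow[OF Bc B(2)] Bc unfolding B(3)[symmetric]
    by (simp add: mat_trace_def diag_mat_def)
  also have "\<dots> = sum_list (map (\<lambda>\<mu>. \<mu> ^ k) es)"
    using es(2) by (simp add: sum_list_sum_nth lessThan_atLeast0)
  also have "\<dots> = (\<Sum>\<mu>\<in>#mset es. \<mu> ^ k)"
    by (simp flip: mset_map add: sum_mset_sum_list)
  finally show ?thesis by (simp add: es(1) proots_prod_linear)
qed

lemma smult_mat_mult_vec: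
  fixes A :: "'a :: comm_semiring_0 mat"
  assumes "A \<in> carrier_mat n m" "v \<in> carrier_vec m"
  shows "(k \<cdot>\<^sub>m A) *\<^sub>v v = k \<cdot>\<^sub>v (A *\<^sub>v v)"
  by (rule eq_vecI) (use assms in \<open>auto simp: scalar_prod_def sum_distrib_left mult.assoc\<close>)

text \<open>These are the entries of the powers of the matrix \<open>c\<close>, indexed by vertices
  instead of list positions, so that no ordering of the vertices has to be carried along.\<close>

primrec walk :: "'a set \<Rightarrow> ('a \<Rightarrow> 'a \<Rightarrow> 'b :: comm_ring_1) \<Rightarrow> nat \<Rightarrow> 'a \<Rightarrow> 'a \<Rightarrow> 'b" where
  "walk V c 0 u v = (if u = v then 1 else 0)"
| "walk V c (Suc k) u v = (\<Sum>w\<in>V. walk V c k u w * c w v)"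

lemma sum_nth_distinct:
  assumes "distinct xs"
  shows "(\<Sum>i<length xs. f (xs ! i)) = sum f (set xs)"
  by (rule sum.reindex_bij_betw, rule bij_betw_nth) (use assms in auto)

lemma pow_mat_eq_walk:
  fixes c :: "'a \<Rightarrow> 'a \<Rightarrow> int"
  assumes "distinct xs"
  defines "A \<equiv> mat (length xs) (length xs) (\<lambda>(i, j). of_int (c (xs ! i) (xs ! j)) :: complex)"
  assumes "i < length xs" "j < length xs"
  shows "(A ^\<^sub>m k) $$ (i, j) = of_int (walk (set xs) c k (xs ! i) (xs ! j))"
  using assms(4)
proof (induction k arbitrary: j)
  case 0
  then show ?case using assms by (simp add: nth_eq_iff_index_eq)
next
  case (Suc k)
  have "(A ^\<^sub>m Suc k) $$ (i, j) = (\<Sum>p<length xs. (A ^\<^sub>m k) $$ (i, p) * A $$ (p, j))"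
    using assms(3) Suc.prems by (simp add: A_def scalar_prod_def lessThan_atLeast0)
  also have "\<dots> = (\<Sum>p<length xs. of_int (walk (set xs) c k (xs ! i) (xs ! p) * c (xs ! p) (xs ! j)))"
    using Suc by (intro sum.cong) (auto simp: A_def)
  also have "\<dots> = (\<Sum>w\<in>set xs. of_int (walk (set xs) c k (xs ! i) w * c w (xs ! j)))"
    using assms(1) by (rule sum_nth_distinct)
  finally show ?case by simp
qed

lemma walk_add:
  assumes "finite V" "u \<in> V" "v \<in> V"
  shows "walk V c (j + k) u v = (\<Sum>w\<in>V. walk V c j u w * walk V c k w v)"
  using assms(3)
proof (induction k arbitrary: v)
  case 0
  have "(\<Sum>w\<in>V. walk V c j u w * walk V c 0 w v) = (\<Sum>w\<in>V. if w = v then walk V c j u w else 0)"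
    by (intro sum.cong) auto
  then show ?case using assms(1) 0 by simp
next
  case (Suc k)
  have "walk V c (j + Suc k) u v
      = (\<Sum>z\<in>V. (\<Sum>w\<in>V. walk V c j u w * walk V c k w z) * c z v)"
    using Suc.IH by simp
  also have "\<dots> = (\<Sum>w\<in>V. walk V c j u w * (\<Sum>z\<in>V. walk V c k w z * c z v))"
    by (subst sum_distrib_left, subst sum.swap) (simp add: sum_distrib_right mult.assoc)
  finally show ?case by simp
qed

lemma walk_1:
  assumes "finite V" "u \<in> V"
  shows "walk V c (Suc 0) u v = c u v"
proof -
  have "walk V c (Suc 0) u v = (\<Sum>w\<in>V. if u = w then c w v else 0)"
    by (simp, intro sum.cong) auto
  then show ?thesis using assms by simp
qed

lemma walk_sym:
  assumes "finite V" "\<And>u v. c u v = c v u" "u \<in> V" "v \<in> V"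
  shows "walk V c k u v = walk V c k v u"
  using assms(3,4)
proof (induction k arbitrary: u v)
  case (Suc k)
  have "walk V c (Suc k) u v = (\<Sum>w\<in>V. c v w * walk V c k w u)"
    unfolding walk.simps
    by (intro sum.cong refl) (simp add: Suc.IH[OF Suc.prems(1)] assms(2)[of _ v] mult.commute)
  \<comment> \<open>\<open>walk\<close> appends its last step, so the reversed walk, which gains a
    first step, is recovered through \<open>walk_add\<close>.\<close>
  also have "\<dots> = walk V c (1 + k) v u"
    using walk_add[OF assms(1) Suc.prems(2,1), of c 1 k] walk_1[OF assms(1) Suc.prems(2), of c]
    by simp
  finally show ?case by simp
qed auto

section \<open>Spectrum and degrees of a signed graph in terms of walks\<close>

lemma adj_entry_sym: "adj_entry G u v = adj_entry G v u"
  by (simp add: adj_entry_def insert_commute)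

context signed_graph
begin

lemma spectrum_mat:
  assumes "distinct xs" "set xs = verts G"
  defines "A \<equiv> mat (length xs) (length xs) (\<lambda>(i, j). of_int (adj_entry G (xs ! i) (xs ! j)) :: complex)"
  shows "sg_spectrum G = proots (char_poly A)"
proof -
  have "map_mat of_int (adj_matrix G xs) = A" by (auto simp: adj_matrix_def A_def)
  then show ?thesis using sg_spectrum_eq[OF assms(1,2)] by simp
qed

lemma size_spectrum: "size (sg_spectrum G) = card (verts G)"
proof -
  obtain xs where xs: "distinct xs" "set xs = verts G"
    using finite_distinct_list[OF finite_verts] by auto
  show ?thesis
    unfolding spectrum_mat[OF xs] size_proots_complex
    by (subst degree_monic_char_poly[THEN conjunct1]) (use xs distinct_card[OF xs(1)] in auto)
qed

lemma sum_walk_eq_spectrum: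
  "of_int (\<Sum>v\<in>verts G. walk (verts G) (adj_entry G) k v v) = (\<Sum>\<mu>\<in>#sg_spectrum G. \<mu> ^ k)"
proof -
  obtain xs where xs: "distinct xs" "set xs = verts G"
    using finite_distinct_list[OF finite_verts] by auto
  let ?A = "mat (length xs) (length xs) (\<lambda>(i, j). of_int (adj_entry G (xs ! i) (xs ! j)) :: complex)"
  have "(\<Sum>\<mu>\<in>#sg_spectrum G. \<mu> ^ k) = mat_trace (?A ^\<^sub>m k)"
    unfolding spectrum_mat[OF xs] by (rule mat_trace_pow[symmetric, of _ "length xs"]) simp
  also have "\<dots> = (\<Sum>i<length xs. of_int (walk (verts G) (adj_entry G) k (xs ! i) (xs ! i)))"
    using pow_mat_eq_walk[OF xs(1)] xs(2) by (simp add: mat_trace_def)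
  also have "\<dots> = of_int (\<Sum>v\<in>verts G. walk (verts G) (adj_entry G) k v v)"
    using sum_nth_distinct[OF xs(1)] xs(2) by simp
  finally show ?thesis by simp
qed

text \<open>Each root of the characteristic polynomial has a nonzero eigenvector. Applying the
  matrix identity \<open>A^3 = K A\<close> to it and comparing one nonzero coordinate gives the
  scalar equation.\<close>

lemma spectrum_cubic:
  assumes cube: "\<And>u v. u \<in> verts G \<Longrightarrow> v \<in> verts G \<Longrightarrow>
      walk (verts G) (adj_entry G) 3 u v = K * adj_entry G u v"
    and "\<mu> \<in># sg_spectrum G"
  shows "\<mu> ^ 3 = of_int K * \<mu>"
proof -
  obtain xs where xs: "distinct xs" "set xs = verts G"
    using finite_distinct_list[OF finite_verts] by auto
  let ?n = "length xs"
  let ?A = "mat ?n ?n (\<lambda>(i, j). of_int (adj_entry G (xs ! i) (xs ! j)) :: complex)"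
  have A: "?A \<in> carrier_mat ?n ?n" by simp
  have "char_poly ?A \<noteq> 0" using degree_monic_char_poly[OF A] by auto
  then have "poly (char_poly ?A) \<mu> = 0"
    using assms(2) unfolding spectrum_mat[OF xs] by simp
  then have "eigenvalue ?A \<mu>" using eigenvalue_root_char_poly[OF A] by blast
  then obtain v where v: "eigenvector ?A v \<mu>" by (auto simp: eigenvalue_def)
  then have vd: "v \<in> carrier_vec ?n" "v \<noteq> 0\<^sub>v ?n" "?A *\<^sub>v v = \<mu> \<cdot>\<^sub>v v"
    by (auto simp: eigenvector_def)
  have "?A ^\<^sub>m 3 = of_int K \<cdot>\<^sub>m ?A"
  proof (rule eq_matI)
    fix i j assume "i < dim_row (of_int K \<cdot>\<^sub>m ?A)" "j < dim_col (of_int K \<cdot>\<^sub>m ?A)"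
    then have ij: "i < ?n" "j < ?n" by auto
    then have "xs ! i \<in> verts G" "xs ! j \<in> verts G" unfolding xs(2)[symmetric] by simp_all
    from cube[OF this] show "(?A ^\<^sub>m 3) $$ (i, j) = (of_int K \<cdot>\<^sub>m ?A) $$ (i, j)"
      using ij by (subst pow_mat_eq_walk[OF xs(1)]) (simp_all add: xs(2))
  qed auto
  then have "\<mu> ^ 3 \<cdot>\<^sub>v v = (of_int K \<cdot>\<^sub>m ?A) *\<^sub>v v"
    using eigenvector_pow[OF A v, of 3] by simp
  also have "\<dots> = of_int K \<cdot>\<^sub>v (?A *\<^sub>v v)" by (rule smult_mat_mult_vec[OF A vd(1)])
  finally have eq: "\<mu> ^ 3 \<cdot>\<^sub>v v = of_int K \<cdot>\<^sub>v (\<mu> \<cdot>\<^sub>v v)" by (simp add: vd)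
  obtain i where i: "i < ?n" "v $ i \<noteq> 0"
    using vd(1,2) by (metis carrier_vecD eq_vecI index_zero_vec(1,2))
  have "(\<mu> ^ 3 \<cdot>\<^sub>v v) $ i = (of_int K \<cdot>\<^sub>v (\<mu> \<cdot>\<^sub>v v)) $ i" by (simp only: eq)
  then show ?thesis using i vd(1) by simp
qed

text \<open>Edges at \<open>v\<close> correspond to neighbours of \<open>v\<close>, and squaring an
  entry removes its sign.\<close>

lemma vdegree_eq_sum:
  assumes "v \<in> verts G"
  shows "int (vdegree G v) = (\<Sum>w\<in>verts G. (adj_entry G v w)\<^sup>2)"
proof -
  have loop: "w \<noteq> v" if "{v, w} \<in> edges G" for w
    using edge_card[OF that] by auto
  have "bij_betw (\<lambda>w. {v, w}) {w \<in> verts G. {v, w} \<in> edges G} {e \<in> edges G. v \<in> e}"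
  proof (rule bij_betw_imageI)
    show "inj_on (\<lambda>w. {v, w}) {w \<in> verts G. {v, w} \<in> edges G}"
      by (auto simp: inj_on_def doubleton_eq_iff)
    show "(\<lambda>w. {v, w}) ` {w \<in> verts G. {v, w} \<in> edges G} = {e \<in> edges G. v \<in> e}"
    proof (intro equalityI subsetI; clarsimp)
      fix e assume e: "e \<in> edges G" "v \<in> e"
      then obtain a b where "e = {a, b}" using edge_card[OF e(1)] by (auto simp: card_2_iff)
      then obtain w where "e = {v, w}" using e(2) by auto
      then show "e \<in> (\<lambda>w. {v, w}) ` {w \<in> verts G. {v, w} \<in> edges G}"
        using e edge_subset[OF e(1)] by auto
    qed
  qed
  then have "vdegree G v = card {w \<in> verts G. {v, w} \<in> edges G}"
    by (simp add: vdegree_def bij_betw_same_card)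
  also have "int \<dots> = (\<Sum>w\<in>{w \<in> verts G. {v, w} \<in> edges G}. 1)" by simp
  also have "\<dots> = (\<Sum>w\<in>verts G. if {v, w} \<in> edges G then 1 else 0)"
    using finite_verts by (subst sum.inter_filter) auto
  also have "\<dots> = (\<Sum>w\<in>verts G. (adj_entry G v w)\<^sup>2)"
  proof (intro sum.cong refl)
    fix w
    have "esign G {v, w} \<in> {1, -1}" if "{v, w} \<in> edges G" using edge_sign[OF that] .
    then show "(if {v, w} \<in> edges G then 1 else 0) = (adj_entry G v w)\<^sup>2"
      by (auto simp: adj_entry_def)
  qed
  finally show ?thesis .
qed

end

subsection \<open>Integer multiples of projections\<close>

text \<open>The matrix \<open>N\<close> is \<open>K\<close> times an orthogonal projection; ranks are expressed by the trace.\<close>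

locale scaled_projection =
  fixes V :: "'a set" and N :: "'a \<Rightarrow> 'a \<Rightarrow> int" and K :: int
  assumes fin: "finite V"
    and sym: "N u v = N v u"
    and sq: "u \<in> V \<Longrightarrow> v \<in> V \<Longrightarrow> (\<Sum>w\<in>V. N u w * N w v) = K * N u v"
begin

lemma sum_square_row: "u \<in> V \<Longrightarrow> (\<Sum>w\<in>V. (N w u)\<^sup>2) = K * N u u"
proof -
  assume u: "u \<in> V"
  have "(\<Sum>w\<in>V. (N w u)\<^sup>2) = (\<Sum>w\<in>V. N u w * N w u)"
    by (intro sum.cong refl) (metis power2_eq_square sym)
  then show ?thesis using sq[OF u u] by simp
qed

text \<open>Column \<open>u\<close> is fixed by \<open>N\<close> up to the factor \<open>K\<close>
  and has square norm \<open>K * N u u = K\<close>, so its outer product with itself is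
  \<open>K\<close> times the projection onto a line in the range of \<open>N\<close>. Splitting off
  that line leaves \<open>K\<close> times the projection onto its orthogonal complement in the
  range.\<close>

lemma deflate:
  assumes u: "u \<in> V" "N u u = 1"
  shows "scaled_projection V (\<lambda>i j. N i j - N i u * N j u) K"
proof
  fix i j assume ij: "i \<in> V" "j \<in> V"
  have "(\<Sum>w\<in>V. (N i w - N i u * N w u) * (N w j - N w u * N j u))
      = (\<Sum>w\<in>V. N i w * N w j) - N j u * (\<Sum>w\<in>V. N i w * N w u)
        - N i u * (\<Sum>w\<in>V. N u w * N w j) + N i u * N j u * (\<Sum>w\<in>V. N u w * N w u)"
    unfolding sum_distrib_left sum_subtractf[symmetric] sum.distrib[symmetric]
  proof (intro sum.cong refl)
    fix w
    show "(N i w - N i u * N w u) * (N w j - N w u * N j u)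
        = N i w * N w j - N j u * (N i w * N w u) - N i u * (N u w * N w j)
          + N i u * N j u * (N u w * N w u)"
      unfolding sym[of u w] by (simp add: algebra_simps)
  qed
  also have "\<dots> = K * (N i j - N i u * N j u)"
    unfolding sq[OF ij] sq[OF ij(1) u(1)] sq[OF u(1) ij(2)] sq[OF u(1) u(1)] u(2) sym[of u j]
    by (simp add: algebra_simps)
  finally show "(\<Sum>w\<in>V. (N i w - N i u * N w u) * (N w j - N w u * N j u))
      = K * (N i j - N i u * N j u)" .
qed (use fin sym in \<open>simp_all add: mult.commute\<close>)

text \<open>By \<open>sum_square_row\<close> the sum of the squares of all entries is
  \<open>K\<close> times the trace.\<close>

lemma eq_zero_if_trace_zero:
  assumes "(\<Sum>v\<in>V. N v v) = 0" "i \<in> V" "j \<in> V"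
  shows "N i j = 0"
proof -
  have "(\<Sum>u\<in>V. \<Sum>w\<in>V. (N w u)\<^sup>2) = K * (\<Sum>v\<in>V. N v v)"
    by (simp add: sum_square_row sum_distrib_left)
  then have zero: "(\<Sum>u\<in>V. \<Sum>w\<in>V. (N w u)\<^sup>2) = 0" using assms(1) by simp
  have "\<forall>u\<in>V. (\<Sum>w\<in>V. (N w u)\<^sup>2) = 0"
    using zero by (subst (asm) sum_nonneg_eq_0_iff) (auto intro: fin sum_nonneg)
  then have "\<forall>u\<in>V. \<forall>w\<in>V. (N w u)\<^sup>2 = 0"
    by (simp add: sum_nonneg_eq_0_iff fin)
  then show ?thesis using assms by simp
qed

text \<open>Deflation at \<open>u\<close> lowers the trace by the square norm of column
  \<open>u\<close>, which is \<open>K\<close>; the remainder has trace 0 and therefore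
  vanishes.\<close>

lemma rank_one:
  assumes u: "u \<in> V" "N u u = 1" and tr: "(\<Sum>v\<in>V. N v v) = K" and "i \<in> V" "j \<in> V"
  shows "N i j = N i u * N j u"
proof -
  interpret D: scaled_projection V "\<lambda>i j. N i j - N i u * N j u" K by (rule deflate[OF u])
  have "(\<Sum>v\<in>V. N v v - N v u * N v u) = 0"
    using sum_square_row[OF u(1)] u(2) tr by (simp add: sum_subtractf power2_eq_square)
  then show ?thesis using D.eq_zero_if_trace_zero[OF _ assms(4,5)] by simp
qed

lemma rank_two:
  assumes tr: "(\<Sum>v\<in>V. N v v) = 2 * K" and K: "K \<ge> 0"
    and many: "int (card {v \<in> V. N v v = 1}) \<ge> K + 1"
  obtains s t where "s \<in> V" "t \<in> V" "N s s = 1" "N t t = 1" "N s t = 0"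
    "\<And>i j. i \<in> V \<Longrightarrow> j \<in> V \<Longrightarrow> N i j = N i s * N j s + N i t * N j t"
proof -
  let ?U = "{v \<in> V. N v v = 1}"
  have "?U \<noteq> {}"
  proof
    assume "?U = {}"
    then have "card ?U = 0" by (simp only: card.empty)
    then show False using many K by linarith
  qed
  then obtain s where s: "s \<in> V" "N s s = 1" by blast
  have "\<exists>t\<in>?U. N t s = 0"
  proof (rule ccontr)
    assume nz: "\<not> ?thesis"
    have "int (card ?U) = (\<Sum>w\<in>?U. 1)" by simp
    also have "\<dots> \<le> (\<Sum>w\<in>?U. (N w s)\<^sup>2)"
    proof (rule sum_mono)
      fix w assume "w \<in> ?U"
      then have "N w s \<noteq> 0" using nz by blast
      then have "(N w s)\<^sup>2 > 0" by simp
      then show "1 \<le> (N w s)\<^sup>2" by linarith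
    qed
    also have "\<dots> \<le> (\<Sum>w\<in>V. (N w s)\<^sup>2)"
      using fin by (intro sum_mono2) auto
    also have "\<dots> = K" using sum_square_row[OF s(1)] s(2) by simp
    finally show False using many by simp
  qed
  then obtain t where t: "t \<in> V" "N t t = 1" "N t s = 0" by blast
  interpret D: scaled_projection V "\<lambda>i j. N i j - N i s * N j s" K by (rule deflate[OF s])
  have trD: "(\<Sum>v\<in>V. N v v - N v s * N v s) = K"
    using sum_square_row[OF s(1)] s(2) tr by (simp add: sum_subtractf power2_eq_square)
  \<comment> \<open>Since \<open>N t s = 0\<close>, deflation at \<open>s\<close> changes neither
    column \<open>t\<close> nor its diagonal entry, so the remainder, now of trace \<open>K\<close>,
    can be split at \<open>t\<close>.\<close>
  have tD: "N t t - N t s * N t s = 1" using t by simp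
  have "N i j = N i s * N j s + N i t * N j t" if "i \<in> V" "j \<in> V" for i j
    using D.rank_one[OF t(1) tD trD that] t(3) by simp
  then show thesis using that[OF s(1) t(1) s(2) t(2)] t(3) by (simp add: sym[of s t])
qed

end

section \<open>The cubic identity and the spectrum determine each other\<close>

context signed_graph
begin

abbreviation awalk :: "nat \<Rightarrow> 'a \<Rightarrow> 'a \<Rightarrow> int" where
  "awalk \<equiv> walk (verts G) (adj_entry G)"

lemma awalk_add:
  assumes "u \<in> verts G" "v \<in> verts G"
  shows "(\<Sum>w\<in>verts G. awalk j u w * awalk k w v) = awalk (j + k) u v"
  by (rule walk_add[symmetric, OF finite_verts assms])

lemma awalk_sym:
  assumes "u \<in> verts G" "v \<in> verts G"
  shows "awalk k u v = awalk k v u"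
  by (rule walk_sym[OF finite_verts adj_entry_sym assms])

lemma awalk_1: "u \<in> verts G \<Longrightarrow> awalk 1 u v = adj_entry G u v"
  using walk_1[OF finite_verts] by simp

lemma awalk_2:
  assumes "u \<in> verts G" "v \<in> verts G"
  shows "awalk 2 u v = (\<Sum>w\<in>verts G. adj_entry G u w * adj_entry G w v)"
proof -
  have "awalk 2 u v = (\<Sum>w\<in>verts G. awalk 1 u w * awalk 1 w v)"
    unfolding awalk_add[OF assms] by (simp only: one_add_one)
  also have "\<dots> = (\<Sum>w\<in>verts G. adj_entry G u w * adj_entry G w v)"
    using assms by (intro sum.cong refl) (simp only: awalk_1)
  finally show ?thesis .
qed

lemma vdegree_eq_awalk:
  assumes v: "v \<in> verts G"
  shows "int (vdegree G v) = awalk 2 v v"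
  by (simp add: vdegree_eq_sum[OF v] awalk_2[OF v v] power2_eq_square adj_entry_sym[of _ _ v])

lemma adj_entry_loop: "adj_entry G v v = 0"
  using edge_card[of "{v, v}"] by (auto simp: adj_entry_def)

text \<open>Only power sums of the spectrum enter. The traces of \<open>A^2\<close>,
  \<open>A^4\<close>, \<open>A^6\<close> are \<open>2pK\<close>, \<open>2pK^2\<close>,
  \<open>2pK^3\<close>, so the symmetric matrix \<open>A^3 - K A\<close> has a square of trace
  \<open>2pK^3 (1 - 2 + 1) = 0\<close>, and a sum of squares equal to 0 has only zero terms.\<close>

lemma cubic_of_spectrum:
  assumes spec: "sg_spectrum G = replicate_mset p (- L) + replicate_mset q 0 + replicate_mset p L"
    and L: "L\<^sup>2 = of_int K" and uv: "u \<in> verts G" "v \<in> verts G"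
  shows "awalk 3 u v = K * adj_entry G u v"
proof -
  let ?V = "verts G"
  define T where "T k = (\<Sum>v\<in>?V. awalk k v v)" for k
  \<comment> \<open>The exponent starts at 2 because the \<open>q\<close> zero eigenvalues would
    contribute to the power 0.\<close>
  have T: "T (2 * Suc k) = 2 * int p * K ^ Suc k" for k
  proof -
    have "of_int (T (2 * Suc k)) = (\<Sum>\<mu>\<in>#sg_spectrum G. \<mu> ^ (2 * Suc k))"
      unfolding T_def by (rule sum_walk_eq_spectrum)
    also have "\<dots> = 2 * of_nat p * (L\<^sup>2) ^ Suc k"
      unfolding spec by (simp add: power_mult power2_eq_square)
    finally have "of_int (T (2 * Suc k)) = (of_int (2 * int p * K ^ Suc k) :: complex)"
      unfolding L by simp
    then show ?thesis by (simp only: of_int_eq_iff)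
  qed
  have prod: "(\<Sum>u\<in>?V. \<Sum>v\<in>?V. awalk j u v * awalk k u v) = T (j + k)" for j k
    unfolding T_def
  proof (intro sum.cong refl)
    fix u assume u: "u \<in> ?V"
    have "(\<Sum>v\<in>?V. awalk j u v * awalk k u v) = (\<Sum>v\<in>?V. awalk j u v * awalk k v u)"
      using u by (intro sum.cong refl) (simp only: awalk_sym)
    then show "(\<Sum>v\<in>?V. awalk j u v * awalk k u v) = awalk (j + k) u u"
      using awalk_add[OF u u] by simp
  qed
  \<comment> \<open>The sum of squares of the entries of \<open>A\<^sup>3 - K A\<close> is the trace of its square.\<close>
  have "(\<Sum>u\<in>?V. \<Sum>v\<in>?V. (awalk 3 u v - K * awalk 1 u v)\<^sup>2)
      = (\<Sum>u\<in>?V. \<Sum>v\<in>?V. awalk 3 u v * awalk 3 u v)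
        - 2 * K * (\<Sum>u\<in>?V. \<Sum>v\<in>?V. awalk 3 u v * awalk 1 u v)
        + K\<^sup>2 * (\<Sum>u\<in>?V. \<Sum>v\<in>?V. awalk 1 u v * awalk 1 u v)"
    unfolding sum_distrib_left sum_subtractf[symmetric] sum.distrib[symmetric]
    by (intro sum.cong refl) (simp only: power2_eq_square algebra_simps mult_2)
  also have "\<dots> = T (2 * Suc 2) - 2 * K * T (2 * Suc 1) + K\<^sup>2 * T (2 * Suc 0)"
    unfolding prod by (simp add: numeral_eq_Suc)
  also have "\<dots> = 0"
    unfolding T by (simp add: eval_nat_numeral)
  finally have "\<forall>u\<in>?V. (\<Sum>v\<in>?V. (awalk 3 u v - K * awalk 1 u v)\<^sup>2) = 0"
    by (subst (asm) sum_nonneg_eq_0_iff) (auto intro: finite_verts sum_nonneg)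
  then have "\<forall>u\<in>?V. \<forall>v\<in>?V. (awalk 3 u v - K * awalk 1 u v)\<^sup>2 = 0"
    by (simp only: sum_nonneg_eq_0_iff finite_verts zero_le_power2)
  then have "(awalk 3 u v - K * awalk 1 u v)\<^sup>2 = 0" using uv by blast
  then have "awalk 3 u v = K * awalk 1 u v" by (simp only: power_eq_0_iff) simp
  then show ?thesis by (simp only: awalk_1[OF uv(1)])
qed

text \<open>The cubic confines the eigenvalues to 0, \<open>L\<close> and \<open>- L\<close>. Three
  equations then fix the three multiplicities: the trace of \<open>A\<close> is 0, the trace of
  \<open>A^2\<close> is given, and the total is the number of vertices.\<close>

lemma spectrum_of_cubic:
  assumes cube: "\<And>u v. u \<in> verts G \<Longrightarrow> v \<in> verts G \<Longrightarrow> awalk 3 u v = K * adj_entry G u v"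
    and L: "L\<^sup>2 = of_int K" "L \<noteq> 0"
    and deg: "(\<Sum>v\<in>verts G. awalk 2 v v) = 2 * int p * K"
    and card: "card (verts G) = 2 * p + q"
  shows "sg_spectrum G = replicate_mset p (- L) + replicate_mset q 0 + replicate_mset p L"
proof -
  let ?S = "sg_spectrum G"
  define a b z where "a = count ?S L" and "b = count ?S (- L)" and "z = count ?S 0"
  have "\<mu> = L \<or> \<mu> = - L \<or> \<mu> = 0" if "\<mu> \<in># ?S" for \<mu>
  proof -
    have "\<mu> ^ 3 = L\<^sup>2 * \<mu>" using spectrum_cubic[OF cube that] L(1) by simp
    then have "(\<mu> - L) * (\<mu> + L) * \<mu> = 0"
      by (simp add: power2_eq_square power3_eq_cube algebra_simps)
    then show ?thesis by (auto simp: eq_neg_iff_add_eq_0)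
  qed
  then have supp: "count ?S \<mu> = 0" if "\<mu> \<noteq> L" "\<mu> \<noteq> - L" "\<mu> \<noteq> 0" for \<mu>
    using that by (auto simp: count_eq_zero_iff)
  have ne: "L \<noteq> - L" "- L \<noteq> L" using L(2) by (simp_all add: eq_neg_iff_add_eq_0 neg_eq_iff_add_eq_0)
  have S: "?S = replicate_mset b (- L) + replicate_mset z 0 + replicate_mset a L"
    using ne L(2) supp by (intro multiset_eqI) (auto simp: a_def b_def z_def)
  have "(\<Sum>\<mu>\<in>#?S. \<mu> ^ 1) = of_int (\<Sum>v\<in>verts G. awalk 1 v v)"
    by (rule sum_walk_eq_spectrum[symmetric])
  also have "(\<Sum>v\<in>verts G. awalk 1 v v) = 0"
    by (intro sum.neutral ballI) (simp only: awalk_1 adj_entry_loop)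
  finally have "(of_nat a - of_nat b) * L = 0"
    unfolding S by (simp add: algebra_simps)
  then have "a = b" using L(2) by simp
  have "(\<Sum>\<mu>\<in>#?S. \<mu> ^ 2) = of_int (\<Sum>v\<in>verts G. awalk 2 v v)"
    by (rule sum_walk_eq_spectrum[symmetric])
  then have "of_nat (a + b) * L\<^sup>2 = of_nat (2 * p) * L\<^sup>2"
    unfolding S deg L(1)[symmetric] by (simp add: L(1) algebra_simps)
  then have "a + b = 2 * p" using L(2) by (simp only: mult_cancel_right power_eq_0_iff of_nat_eq_iff) simp
  then have "a = p" "b = p" using \<open>a = b\<close> by simp_all
  moreover have "z = q"
    using size_spectrum calculation unfolding S card by simp
  ultimately show ?thesis using S by simp
qed

end

subsection \<open>Adding a vertex\<close>

text \<open>Passing to \<open>'a option\<close> guarantees a fresh vertex \<open>None\<close>. An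
  entry 0 of \<open>x\<close> means no edge to it; the other entries are the signs of the new edges,
  found by recovering the old endpoint.\<close>

definition cone :: "'a sgraph \<Rightarrow> ('a \<Rightarrow> int) \<Rightarrow> 'a option sgraph" where
  "cone G x = \<lparr>verts = insert None (Some ` verts G),
     edges = image Some ` edges G \<union> (\<lambda>v. {None, Some v}) ` {v \<in> verts G. x v \<noteq> 0},
     esign = (\<lambda>e. if None \<in> e then x (THE v. Some v \<in> e) else esign G (Some -` e))\<rparr>"

lemma sum_verts_cone:
  assumes "finite (verts G)"
  shows "(\<Sum>p\<in>verts (cone G x). f p) = f None + (\<Sum>v\<in>verts G. f (Some v))"
  using assms by (simp add: cone_def sum.insert sum.reindex)

text \<open>In matrix terms the adjacency matrix of the cone is \<open>A\<close> bordered by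
  \<open>x\<close>. The walk computations in the cone rest on these entries.\<close>

lemma adj_entry_cone:
  shows "adj_entry (cone G x) (Some u) (Some v) = adj_entry G u v"
    and "v \<in> verts G \<Longrightarrow> adj_entry (cone G x) None (Some v) = x v"
proof -
  have e: "{Some u, Some v} = Some ` {u, v}" by simp
  have "{Some u, Some v} \<in> edges (cone G x) \<longleftrightarrow> {u, v} \<in> edges G"
    unfolding cone_def e by (auto simp: inj_image_eq_iff simp flip: image_insert image_empty)
  moreover have "esign (cone G x) {Some u, Some v} = esign G {u, v}"
    unfolding e by (simp add: cone_def inj_vimage_image_eq del: image_insert)
  ultimately show "adj_entry (cone G x) (Some u) (Some v) = adj_entry G u v"
    by (simp add: adj_entry_def)
  assume v: "v \<in> verts G"
  have "{None, Some v} \<in> edges (cone G x) \<longleftrightarrow> x v \<noteq> 0"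
  proof -
    have "inj (\<lambda>v. {None, Some v})"
      by (rule injI) (simp add: doubleton_eq_iff)
    then have "{None, Some v} \<in> (\<lambda>v. {None, Some v}) ` {v \<in> verts G. x v \<noteq> 0} \<longleftrightarrow> x v \<noteq> 0"
      using v by (subst inj_image_mem_iff[where f = "\<lambda>v. {None, Some v}"]) simp_all
    moreover have "{None, Some v} \<noteq> Some ` e" for e
      by (metis imageE insertI1 option.distinct(1))
    ultimately show ?thesis by (auto simp: cone_def)
  qed
  moreover have "esign (cone G x) {None, Some v} = x v"
    by (simp add: cone_def)
  ultimately show "adj_entry (cone G x) None (Some v) = x v"
    by (simp add: adj_entry_def)
qed

context signed_graph
begin

lemma signed_graph_cone:
  assumes "\<And>v. v \<in> verts G \<Longrightarrow> x v \<in> {-1, 0, 1}"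
  shows "signed_graph (cone G x)"
proof
  show "finite (verts (cone G x))" using finite_verts by (simp add: cone_def)
  fix e assume "e \<in> edges (cone G x)"
  then consider (old) e' where "e = Some ` e'" "e' \<in> edges G"
    | (new) v where "e = {None, Some v}" "v \<in> verts G" "x v \<noteq> 0"
    by (auto simp: cone_def)
  then have "e \<subseteq> verts (cone G x) \<and> card e = 2 \<and> esign (cone G x) e \<in> {1, -1}"
  proof cases
    case old
    have "card e = 2" using edge_card[OF old(2)] old(1) by (simp add: card_image)
    moreover have "esign (cone G x) e = esign G e'"
      using old(1) by (auto simp: cone_def inj_vimage_image_eq)
    ultimately show ?thesis
      using edge_sign[OF old(2)] edge_subset[OF old(2)] old(1) by (auto simp: cone_def)
  next
    case new
    then show ?thesis using assms[OF new(2)] by (auto simp: cone_def)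
  qed
  then show "e \<subseteq> verts (cone G x)" "card e = 2" "esign (cone G x) e \<in> {1, -1}" by auto
qed

text \<open>The two graphs live on different types, so deletion can give \<open>G\<close> back only
  up to isomorphism, here along \<open>the\<close>.\<close>

lemma delete_apex_isomorphic: "sg_isomorphic (delete_vertex (cone G x) None) G"
  unfolding sg_isomorphic_def
proof (intro exI[of _ the] conjI)
  have E: "edges (delete_vertex (cone G x) None) = image Some ` edges G"
    by (auto simp: delete_vertex_def cone_def)
  have the_Some: "the ` Some ` e = e" for e :: "'a set" by (simp add: image_image)
  show "bij_betw the (verts (delete_vertex (cone G x) None)) (verts G)"
    by (rule bij_betwI[of _ _ _ Some]) (auto simp: delete_vertex_def cone_def)
  show "edges G = (\<lambda>e. the ` e) ` edges (delete_vertex (cone G x) None)"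
    unfolding E by (simp add: image_image)
  show "\<forall>e\<in>edges (delete_vertex (cone G x) None).
      esign G (the ` e) = esign (delete_vertex (cone G x) None) e"
    unfolding E
    by (auto simp: the_Some delete_vertex_def cone_def inj_vimage_image_eq)
qed

end

text \<open>In matrix form: \<open>A\<^sup>2 = K I - x x\<^sup>T - y y\<^sup>T\<close> with \<open>x\<close>, \<open>y\<close> orthogonal vectors in the kernel of \<open>A\<close>.\<close>

locale balanced_cone = signed_graph G for G :: "'a sgraph" +
  fixes x y :: "'a \<Rightarrow> int" and K :: int
  assumes signs: "v \<in> verts G \<Longrightarrow> x v \<in> {-1, 0, 1}" "v \<in> verts G \<Longrightarrow> y v \<in> {-1, 0, 1}"
    and adj_square: "u \<in> verts G \<Longrightarrow> v \<in> verts G \<Longrightarrow>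
      awalk 2 u v = (if u = v then K else 0) - x u * x v - y u * y v"
    and adj_x: "u \<in> verts G \<Longrightarrow> (\<Sum>w\<in>verts G. adj_entry G u w * x w) = 0"
    and adj_y: "u \<in> verts G \<Longrightarrow> (\<Sum>w\<in>verts G. adj_entry G u w * y w) = 0"
    and norm_x: "(\<Sum>w\<in>verts G. x w * x w) = K"
    and norm_y: "(\<Sum>w\<in>verts G. y w * y w) = K"
    and orth: "(\<Sum>w\<in>verts G. x w * y w) = 0"
begin

sublocale H: signed_graph "cone G x"
  by (rule signed_graph_cone[OF signs(1)])

lemma verts_cone: "None \<in> verts (cone G x)" "Some v \<in> verts (cone G x) \<longleftrightarrow> v \<in> verts G"
  by (auto simp: cone_def)

lemma adj_entry_apex: "w \<in> verts G \<Longrightarrow> adj_entry (cone G x) (Some w) None = x w"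
  using adj_entry_cone(2)[of w G x] by (simp add: adj_entry_sym[of _ "Some w"])

text \<open>Squaring the bordered matrix adds \<open>x x^T\<close> to \<open>A^2\<close> in the old
  block, which cancels the term \<open>- x x^T\<close> there. The border is \<open>A x = 0\<close>
  and the corner is the square norm \<open>K\<close> of \<open>x\<close>. The square is thus
  \<open>K I - y y^T\<close> with \<open>y\<close> extended by 0.\<close>

lemma cone_walk_2:
  shows "u \<in> verts G \<Longrightarrow> v \<in> verts G \<Longrightarrow>
      H.awalk 2 (Some u) (Some v) = (if u = v then K else 0) - y u * y v"
    and cone_walk_2_apex: "v \<in> verts G \<Longrightarrow> H.awalk 2 None (Some v) = 0"
    and cone_walk_2_apex': "v \<in> verts G \<Longrightarrow> H.awalk 2 (Some v) None = 0"
    and cone_walk_2_apex2: "H.awalk 2 None None = K"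
proof -
  have two: "H.awalk 2 p q = adj_entry (cone G x) p None * adj_entry (cone G x) None q
      + (\<Sum>w\<in>verts G. adj_entry (cone G x) p (Some w) * adj_entry (cone G x) (Some w) q)"
    if "p \<in> verts (cone G x)" "q \<in> verts (cone G x)" for p q
    unfolding H.awalk_2[OF that] by (rule sum_verts_cone[OF finite_verts])
  show "H.awalk 2 (Some u) (Some v) = (if u = v then K else 0) - y u * y v"
    if u: "u \<in> verts G" and v: "v \<in> verts G"
  proof -
    have "H.awalk 2 (Some u) (Some v) = x u * x v + awalk 2 u v"
      using u v by (simp only: two verts_cone adj_entry_cone adj_entry_apex awalk_2)
    then show ?thesis using adj_square[OF u v] by simp
  qed
  show apex: "H.awalk 2 None (Some v) = 0" if v: "v \<in> verts G" for v
  proof -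
    have "H.awalk 2 None (Some v) = (\<Sum>w\<in>verts G. x w * adj_entry G w v)"
      using v by (simp add: two verts_cone adj_entry_cone H.adj_entry_loop del: walk.simps)
    also have "\<dots> = (\<Sum>w\<in>verts G. adj_entry G v w * x w)"
      by (intro sum.cong refl) (metis adj_entry_sym mult.commute)
    finally show ?thesis using adj_x[OF v] by simp
  qed
  show "H.awalk 2 (Some v) None = 0" if v: "v \<in> verts G"
    using apex[OF v] H.awalk_sym[of "Some v" None 2] v by (simp only: verts_cone)
  show "H.awalk 2 None None = K"
    using norm_x by (simp add: two verts_cone adj_entry_cone H.adj_entry_loop adj_entry_apex)
qed

text \<open>Let \<open>B\<close> be the bordered matrix. Multiplying
  \<open>B^2 = K I - y y^T\<close> by \<open>B\<close> leaves \<open>K B\<close>, because the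
  extended \<open>y\<close> lies in the kernel of \<open>B\<close>.\<close>

lemma cone_cubic:
  assumes p: "p \<in> verts (cone G x)" and q: "q \<in> verts (cone G x)"
  shows "H.awalk 3 p q = K * adj_entry (cone G x) p q"
proof -
  have "H.awalk 3 p q = (\<Sum>r\<in>verts (cone G x). H.awalk 2 p r * H.awalk 1 r q)"
    unfolding H.awalk_add[OF p q] by simp
  also have "\<dots> = (\<Sum>r\<in>verts (cone G x). H.awalk 2 p r * adj_entry (cone G x) r q)"
    by (intro sum.cong refl) (simp only: H.awalk_1)
  also have "\<dots> = H.awalk 2 p None * adj_entry (cone G x) None q
      + (\<Sum>w\<in>verts G. H.awalk 2 p (Some w) * adj_entry (cone G x) (Some w) q)"
    by (rule sum_verts_cone[OF finite_verts])
  finally have three: "H.awalk 3 p q = \<dots>" .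
  show ?thesis
  proof (cases p)
    case None
    have "(\<Sum>w\<in>verts G. H.awalk 2 None (Some w) * adj_entry (cone G x) (Some w) q) = 0"
      by (intro sum.neutral ballI) (simp only: cone_walk_2_apex mult_zero_left)
    then show ?thesis using three unfolding None by (simp only: cone_walk_2_apex2 add_0_right)
  next
    case (Some u)
    then have u: "u \<in> verts G" using p by (simp add: verts_cone)
    have expand: "(\<Sum>w\<in>verts G. ((if u = w then K else 0) - y u * y w) * f w)
        = K * f u - y u * (\<Sum>w\<in>verts G. y w * f w)" for f
    proof -
      have "(\<Sum>w\<in>verts G. ((if u = w then K else 0) - y u * y w) * f w)
          = (\<Sum>w\<in>verts G. (if u = w then K * f w else 0) - y u * (y w * f w))"
        by (intro sum.cong refl) (simp add: algebra_simps)
      then show ?thesis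
        using u finite_verts by (simp add: sum_subtractf sum_distrib_left)
    qed
    \<comment> \<open>At the new vertex this is the orthogonality of \<open>x\<close> and
      \<open>y\<close>; at an old vertex it is \<open>A y = 0\<close>.\<close>
    have y_zero: "(\<Sum>w\<in>verts G. y w * adj_entry (cone G x) (Some w) q) = 0"
    proof (cases q)
      case None
      have "(\<Sum>w\<in>verts G. y w * adj_entry (cone G x) (Some w) q) = (\<Sum>w\<in>verts G. x w * y w)"
        unfolding None by (intro sum.cong refl) (simp only: adj_entry_apex mult.commute)
      then show ?thesis using orth by simp
    next
      case (Some v)
      then have v: "v \<in> verts G" using q by (simp add: verts_cone)
      have "(\<Sum>w\<in>verts G. y w * adj_entry (cone G x) (Some w) q)
          = (\<Sum>w\<in>verts G. adj_entry G v w * y w)"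
        unfolding Some
        by (intro sum.cong refl) (metis adj_entry_cone(1) adj_entry_sym mult.commute)
      then show ?thesis using adj_y[OF v] by simp
    qed
    have "(\<Sum>w\<in>verts G. H.awalk 2 (Some u) (Some w) * adj_entry (cone G x) (Some w) q)
        = (\<Sum>w\<in>verts G. ((if u = w then K else 0) - y u * y w) * adj_entry (cone G x) (Some w) q)"
      using u by (intro sum.cong refl) (simp only: cone_walk_2)
    also have "\<dots> = K * adj_entry (cone G x) (Some u) q"
      unfolding expand y_zero by simp
    finally show ?thesis
      using three unfolding Some by (simp only: cone_walk_2_apex'[OF u] mult_zero_left add_0_left)
  qed
qed

text \<open>Degrees are the diagonal entries of \<open>K I - y y^T\<close>, and the entries of
  \<open>y\<close> have square 0 or 1.\<close>

lemma vdegree_cone: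
  assumes "p \<in> verts (cone G x)"
  shows "int (vdegree (cone G x) p) \<in> {K, K - 1}"
proof (cases p)
  case None
  then show ?thesis
    by (simp only: H.vdegree_eq_awalk verts_cone cone_walk_2_apex2) simp
next
  case (Some v)
  then have v: "v \<in> verts G" using assms by (simp add: verts_cone)
  have "int (vdegree (cone G x) p) = K - y v * y v"
    using v unfolding Some by (simp only: H.vdegree_eq_awalk verts_cone cone_walk_2) simp
  then show ?thesis using signs(2)[OF v] by auto
qed

text \<open>The new vertex adds one \<open>K\<close> to the trace of \<open>K I\<close>, and the
  square norm \<open>K\<close> of \<open>y\<close> takes it away.\<close>

lemma trace_cone_square:
  "(\<Sum>p\<in>verts (cone G x). H.awalk 2 p p) = K * int (card (verts G))"
proof -
  have "(\<Sum>p\<in>verts (cone G x). H.awalk 2 p p) = K + (\<Sum>v\<in>verts G. H.awalk 2 (Some v) (Some v))"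
    unfolding sum_verts_cone[OF finite_verts] by (simp only: cone_walk_2_apex2)
  also have "(\<Sum>v\<in>verts G. H.awalk 2 (Some v) (Some v)) = (\<Sum>v\<in>verts G. K - y v * y v)"
    by (intro sum.cong refl) (simp only: cone_walk_2 simp_thms if_True)
  finally show ?thesis using norm_y by (simp add: sum_subtractf mult.commute)
qed

lemma card_cone: "card (verts (cone G x)) = Suc (card (verts G))"
  using finite_verts by (simp add: cone_def card_image)

text \<open>The trace \<open>2pK\<close> of the square gives each of \<open>L\<close> and
  \<open>- L\<close> multiplicity \<open>p\<close>, and the \<open>2p + 1\<close> vertices leave
  room for a single 0.\<close>

lemma spectrum_cone:
  assumes L: "L\<^sup>2 = of_int K" "L \<noteq> 0" and card: "card (verts G) = 2 * p"
  shows "sg_spectrum (cone G x) = replicate_mset p (- L) + replicate_mset 1 0 + replicate_mset p L"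
proof (rule H.spectrum_of_cubic[OF _ L])
  show "H.awalk 3 u v = K * adj_entry (cone G x) u v"
    if "u \<in> verts (cone G x)" "v \<in> verts (cone G x)" for u v
    using that by (rule cone_cubic)
  show "(\<Sum>v\<in>verts (cone G x). H.awalk 2 v v) = 2 * int p * K"
    unfolding trace_cone_square card by simp
  show "card (verts (cone G x)) = 2 * p + 1"
    unfolding card_cone card by simp
qed

end

section \<open>From the cubic identity to the required extension\<close>

text \<open>From \<open>A^3 = K A\<close> follows \<open>A^4 = K A^2\<close>, hence
  \<open>(K I - A^2)^2 = K^2 I - 2 K A^2 + K A^2 = K (K I - A^2)\<close> and
  \<open>A (K I - A^2) = K A - A^3 = 0\<close>.\<close>

lemma (in signed_graph) scaled_projection_of_cubic:
  assumes cube: "\<And>u v. u \<in> verts G \<Longrightarrow> v \<in> verts G \<Longrightarrow> awalk 3 u v = K * adj_entry G u v"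
  \<comment> \<open>The cut-off outside the vertex set makes \<open>M\<close> symmetric on the whole type.\<close>
  defines "M \<equiv> \<lambda>u v. if u \<in> verts G \<and> v \<in> verts G then K * awalk 0 u v - awalk 2 u v else 0"
  shows "scaled_projection (verts G) M K"
    and "u \<in> verts G \<Longrightarrow> v \<in> verts G \<Longrightarrow> (\<Sum>w\<in>verts G. adj_entry G u w * M w v) = 0"
proof -
  show "scaled_projection (verts G) M K"
  proof
    show "finite (verts G)" by (rule finite_verts)
    show "M u v = M v u" for u v
      unfolding M_def using awalk_sym[of u v] by simp
    fix u v assume uv: "u \<in> verts G" "v \<in> verts G"
    have "(\<Sum>w\<in>verts G. M u w * M w v)
        = (\<Sum>w\<in>verts G. (K * awalk 0 u w - awalk 2 u w) * (K * awalk 0 w v - awalk 2 w v))"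
      using uv by (intro sum.cong refl) (simp only: M_def if_True simp_thms)
    also have "\<dots> = K * K * (\<Sum>w\<in>verts G. awalk 0 u w * awalk 0 w v)
        - K * (\<Sum>w\<in>verts G. awalk 0 u w * awalk 2 w v)
        - K * (\<Sum>w\<in>verts G. awalk 2 u w * awalk 0 w v)
        + (\<Sum>w\<in>verts G. awalk 2 u w * awalk 2 w v)"
      unfolding sum_distrib_left sum_subtractf[symmetric] sum.distrib[symmetric]
      by (intro sum.cong refl) (simp only: algebra_simps)
    also have "\<dots> = K * K * awalk 0 u v - 2 * K * awalk 2 u v + awalk 4 u v"
      unfolding awalk_add[OF uv] add_0_left add_0_right by (simp del: walk.simps)
    also have "awalk 4 u v = (\<Sum>w\<in>verts G. awalk 3 u w * awalk 1 w v)"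
      unfolding awalk_add[OF uv] by simp
    also have "\<dots> = (\<Sum>w\<in>verts G. K * (awalk 1 u w * awalk 1 w v))"
      using uv by (intro sum.cong refl) (simp only: cube awalk_1 mult.assoc)
    also have "\<dots> = K * awalk 2 u v"
      unfolding sum_distrib_left[symmetric] awalk_add[OF uv] by (simp only: one_add_one)
    finally show "(\<Sum>w\<in>verts G. M u w * M w v) = K * M u v"
      using uv by (simp add: M_def algebra_simps del: walk.simps)
  qed
  assume uv: "u \<in> verts G" "v \<in> verts G"
  have "(\<Sum>w\<in>verts G. adj_entry G u w * M w v)
      = (\<Sum>w\<in>verts G. awalk 1 u w * (K * awalk 0 w v - awalk 2 w v))"
    using uv by (intro sum.cong refl) (simp only: M_def if_True simp_thms awalk_1)
  also have "\<dots> = K * (\<Sum>w\<in>verts G. awalk 1 u w * awalk 0 w v)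
      - (\<Sum>w\<in>verts G. awalk 1 u w * awalk 2 w v)"
    unfolding sum_distrib_left sum_subtractf[symmetric]
    by (intro sum.cong refl) (simp only: algebra_simps)
  also have "\<dots> = K * awalk 1 u v - awalk 3 u v"
    unfolding awalk_add[OF uv] add_0_right by (simp only: one_plus_numeral add_num_simps)
  also have "\<dots> = 0" using cube[OF uv] awalk_1[OF uv(1)] by simp
  finally show "(\<Sum>w\<in>verts G. adj_entry G u w * M w v) = 0" .
qed

text \<open>The degree hypotheses describe the diagonal \<open>K - deg v\<close> of
  \<open>M\<close>: its sum is \<open>2 K\<close>, its entries are at most 2, and at least
  \<open>K + 1\<close> of them are 1. The vectors \<open>x\<close> and \<open>y\<close> are the two
  columns supplied by \<open>rank_two\<close>.\<close>

lemma (in signed_graph) ex_balanced_cone: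
  assumes cube: "\<And>u v. u \<in> verts G \<Longrightarrow> v \<in> verts G \<Longrightarrow> awalk 3 u v = K * adj_entry G u v"
    and K: "K \<ge> 0"
    and edges: "(\<Sum>v\<in>verts G. int (vdegree G v)) = K * int (card (verts G)) - 2 * K"
    and deg: "\<And>v. v \<in> verts G \<Longrightarrow> K - 2 \<le> int (vdegree G v)"
    and many: "int (card {v \<in> verts G. int (vdegree G v) = K - 1}) \<ge> K + 1"
  shows "\<exists>x y. balanced_cone G x y K"
proof -
  let ?V = "verts G"
  define M where "M = (\<lambda>u v. if u \<in> ?V \<and> v \<in> ?V then K * awalk 0 u v - awalk 2 u v else 0)"
  interpret M: scaled_projection ?V M K
    unfolding M_def by (rule scaled_projection_of_cubic(1)[OF cube])
  have AM: "(\<Sum>w\<in>?V. adj_entry G u w * M w v) = 0" if "u \<in> ?V" "v \<in> ?V" for u v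
    unfolding M_def by (rule scaled_projection_of_cubic(2)[OF cube that])
  have Mvv: "M v v = K - int (vdegree G v)" if "v \<in> ?V" for v
    using that by (simp add: M_def vdegree_eq_awalk del: walk.simps(2))
  have tr: "(\<Sum>v\<in>?V. M v v) = 2 * K"
    using edges by (simp add: Mvv sum_subtractf)
  have "{v \<in> ?V. int (vdegree G v) = K - 1} = {v \<in> ?V. M v v = 1}" using Mvv by auto
  then have many': "int (card {v \<in> ?V. M v v = 1}) \<ge> K + 1"
    using many by (simp only:)
  obtain s t where st: "s \<in> ?V" "t \<in> ?V" "M s s = 1" "M t t = 1" "M s t = 0"
    and decomp: "\<And>i j. i \<in> ?V \<Longrightarrow> j \<in> ?V \<Longrightarrow> M i j = M i s * M j s + M i t * M j t"
    by (fact M.rank_two[OF tr K many'])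
  define x y where "x = (\<lambda>v. M v s)" and "y = (\<lambda>v. M v t)"
  have small: "x v \<in> {-1, 0, 1}" "y v \<in> {-1, 0, 1}" if v: "v \<in> ?V" for v
  proof -
    \<comment> \<open>The diagonal entry equals \<open>(x v)^2 + (y v)^2\<close>, so the bound 2
      keeps both integers between -1 and 1.\<close>
    have "M v v \<le> 2" using deg[OF v] Mvv[OF v] by simp
    then have le: "(x v)\<^sup>2 + (y v)\<^sup>2 \<le> 2"
      using decomp[OF v v] by (simp add: x_def y_def power2_eq_square)
    have "z \<in> {-1, 0, 1}" if "z\<^sup>2 \<le> 2" for z :: int
    proof -
      have "z\<^sup>2 < 2\<^sup>2" using that by simp
      then have "\<bar>z\<bar> < 2" by (intro power2_less_imp_less[of "\<bar>z\<bar>" 2]) simp_all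
      then show ?thesis by auto
    qed
    moreover have "(x v)\<^sup>2 \<le> 2" "(y v)\<^sup>2 \<le> 2"
      using le zero_le_power2[of "x v"] zero_le_power2[of "y v"] by linarith+
    ultimately show "x v \<in> {-1, 0, 1}" "y v \<in> {-1, 0, 1}" by blast+
  qed
  have norm: "(\<Sum>w\<in>?V. x w * x w) = K" "(\<Sum>w\<in>?V. y w * y w) = K"
    using M.sum_square_row[OF st(1)] M.sum_square_row[OF st(2)] st(3,4)
    by (simp_all add: x_def y_def power2_eq_square)
  have "balanced_cone G x y K"
  proof
    fix u v assume uv: "u \<in> ?V" "v \<in> ?V"
    have "M u v = x u * x v + y u * y v"
      using decomp[OF uv] by (simp only: x_def y_def)
    moreover have "M u v = K * awalk 0 u v - awalk 2 u v"
      using uv by (simp only: M_def if_True simp_thms)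
    ultimately have "K * awalk 0 u v - awalk 2 u v = x u * x v + y u * y v" by simp
    then show "awalk 2 u v = (if u = v then K else 0) - x u * x v - y u * y v"
      by (simp del: walk.simps(2) split: if_splits)
  next
    \<comment> \<open>The inner product of columns \<open>s\<close> and \<open>t\<close> is the
      entry of \<open>M^2 = K M\<close> at \<open>s\<close>, \<open>t\<close>, where
      \<open>M\<close> vanishes.\<close>
    have "(\<Sum>w\<in>?V. x w * y w) = (\<Sum>w\<in>?V. M s w * M w t)"
      unfolding x_def y_def by (intro sum.cong refl) (metis M.sym)
    then show "(\<Sum>w\<in>?V. x w * y w) = 0"
      using M.sq[OF st(1,2)] st(5) by simp
  next
    show "x v \<in> {-1, 0, 1}" if "v \<in> ?V" for v by (rule small(1)[OF that])
    show "y v \<in> {-1, 0, 1}" if "v \<in> ?V" for v by (rule small(2)[OF that])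
    show "(\<Sum>w\<in>?V. adj_entry G u w * x w) = 0" if "u \<in> ?V" for u
      unfolding x_def by (rule AM[OF that st(1)])
    show "(\<Sum>w\<in>?V. adj_entry G u w * y w) = 0" if "u \<in> ?V" for u
      unfolding y_def by (rule AM[OF that st(2)])
  qed (fact norm)+
  then show ?thesis by blast
qed

theorem theorem5p7:
  fixes G :: "'a sgraph" and l :: real and m :: nat
  assumes "signed_graph G"
    and "m \<ge> 2"
    and "sg_spectrum G =
           replicate_mset (m - 2) (- complex_of_real l) + replicate_mset 2 0
           + replicate_mset (m - 2) (complex_of_real l)"
    and "\<forall>v \<in> verts G. real (vdegree G v) \<in> {l\<^sup>2, l\<^sup>2 - 1, l\<^sup>2 - 2}"
    and "real (card {v \<in> verts G. real (vdegree G v) = l\<^sup>2 - 1}) \<ge> l\<^sup>2 + 1"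
  shows "\<exists>H :: 'a option sgraph.
           signed_graph H \<and>
           sg_spectrum H =
             replicate_mset (m - 1) (- complex_of_real l) + replicate_mset 1 0
             + replicate_mset (m - 1) (complex_of_real l) \<and>
           (\<forall>v \<in> verts H. real (vdegree H v) \<in> {l\<^sup>2, l\<^sup>2 - 1}) \<and>
           (\<exists>v \<in> verts H. sg_isomorphic (delete_vertex H v) G)"
proof -
  interpret signed_graph G by fact
  let ?V = "verts G" and ?U = "{v \<in> verts G. real (vdegree G v) = l\<^sup>2 - 1}"
  have "?U \<noteq> {}"
  proof
    assume "?U = {}"
    then have "card ?U = 0" by (simp only: card.empty)
    then show False using assms(5) zero_le_power2[of l] by linarith
  qed
  then obtain v0 where v0: "v0 \<in> ?V" "real (vdegree G v0) = l\<^sup>2 - 1" by blast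
  \<comment> \<open>The real number \<open>l^2\<close> is an integer because it exceeds the degree
    of \<open>v0\<close> by 1; this also makes it positive.\<close>
  define K where "K = int (vdegree G v0) + 1"
  have lK: "l\<^sup>2 = of_int K" and K: "K > 0" using v0(2) by (simp_all add: K_def)
  have LK: "(complex_of_real l)\<^sup>2 = of_int K"
    by (metis lK of_real_of_int_eq of_real_power)
  have L0: "complex_of_real l \<noteq> 0" using lK K by auto
  \<comment> \<open>The count \<open>2 (m - 2) + 2\<close> is written as \<open>2 (m - 1)\<close> to
    serve as the instance \<open>p = m - 1\<close> of \<open>spectrum_cone\<close>.\<close>
  have card_V: "card ?V = 2 * (m - 1)"
    using assms(2) unfolding size_spectrum[symmetric] assms(3) by simp
  have "of_int (\<Sum>v\<in>?V. awalk 2 v v) = (\<Sum>\<mu>\<in>#sg_spectrum G. \<mu> ^ 2)"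
    by (rule sum_walk_eq_spectrum)
  also have "\<dots> = of_int (2 * int (m - 2) * K)"
    unfolding assms(3) by (simp add: LK)
  finally have "(\<Sum>v\<in>?V. awalk 2 v v) = 2 * int (m - 2) * K" by (simp only: of_int_eq_iff)
  \<comment> \<open>The trace \<open>2 (m - 2) K\<close> of \<open>A^2\<close> falls short of
    \<open>K\<close> times the \<open>2 (m - 1)\<close> vertices by \<open>2 K\<close>, the trace of
    \<open>M\<close>.\<close>
  then have edges: "(\<Sum>v\<in>?V. int (vdegree G v)) = K * int (card ?V) - 2 * K"
    using assms(2) by (simp add: vdegree_eq_awalk card_V of_nat_diff algebra_simps del: walk.simps)
  have "?U = {v \<in> ?V. int (vdegree G v) = K - 1}" using lK by auto
  then have many: "int (card {v \<in> ?V. int (vdegree G v) = K - 1}) \<ge> K + 1"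
    using assms(5) lK by (simp only:)
  have deg: "K - 2 \<le> int (vdegree G v)" if "v \<in> ?V" for v
    using assms(4) that lK by force
  obtain x y where xy: "balanced_cone G x y K"
    using ex_balanced_cone[OF cubic_of_spectrum[OF assms(3) LK] less_imp_le[OF K] edges deg many]
    by blast
  have "real (vdegree (cone G x) p) \<in> {l\<^sup>2, l\<^sup>2 - 1}" if "p \<in> verts (cone G x)" for p
    using balanced_cone.vdegree_cone[OF xy that] lK by auto
  moreover have "signed_graph (cone G x)"
    by (rule signed_graph_cone[OF balanced_cone.signs(1)[OF xy]])
  ultimately show ?thesis
    using balanced_cone.spectrum_cone[OF xy LK L0 card_V] balanced_cone.verts_cone(1)[OF xy]
      delete_apex_isomorphic by blast
qed

end
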